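(* Let $\mathfrak{g}$ be a finite-dimensional real almost abelian Lie algebra equipped with an inner product $\langle\cdot,\cdot\rangle$. If $2\leq p\leq \dim\mathfrak{g}-2$, then every conformal Killing $p$-form $\omega\in\Lambda^p\mathfrak{g}^*$ on $(\mathfrak{g},\langle\cdot,\cdot\rangle)$ is parallel. In other words, if for some $p$ with $1\le p\le\dim\mathfrak g$ there exists a non-parallel conformal Killing $p$-form on $(\mathfrak{g},\langle\cdot,\cdot\rangle)$, then $p=1$ or $p=\dim\mathfrak{g}-1$.
   Context: A real Lie algebra $\mathfrak{g}$ is almost abelian if it has an abelian ideal of codimension one. Given an inner product $\langle\cdot,\cdot\rangle$ on $\mathfrak{g}$ (equivalently, a left-invariant Riemannian metric on the simply connected Lie group), the Levi-Civita connection is given on $\mathfrak{g}$ by $2\langle\nabla_xy,z\rangle=\langle[x,y],z\rangle-\langle[y,z],x\rangle+\langle[z,x],y\rangle$, and on $p$-forms $\omega\in\Lambda^p\mathfrak{g}^*$ by $(\nabla_x\omega)(x_1,\dots,x_p)=-\sum_i\omega(x_1,\dots,\nabla_xx_i,\dots,x_p)$. The exterior derivative is $d\omega(x_0,\dots,x_p)=\sum_{i<j}(-1)^{i+j}\omega([x_i,x_j],x_0,\dots,\hat{x}_i,\dots,\hat{x}_j,\dots,x_p)$, and the codifferential is $d^*\omega=-\sum_i e_i\lrcorner\nabla_{e_i}\omega$ for any orthonormal basis $\{e_i\}$ of $\mathfrak{g}$. For $x\in\mathfrak{g}$, $x^*=\langle x,\cdot\rangle$. Let $n=\dim\mathfrak{g}$.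 A $p$-form $\omega$ is conformal Killing (CKY) if for all $x\in\mathfrak{g}$ $$\nabla_x\omega=\frac{1}{p+1}\,x\lrcorner d\omega-\frac{1}{n-p+1}\,x^*\wedge d^*\omega.$$ It is parallel if $\nabla_x\omega=0$ for all $x\in\mathfrak{g}$. *)

theory Defs
  imports "HOL-Analysis.Analysis"
begin

text \<open>
  A finite-dimensional real Lie algebra with an inner product is a Euclidean space \<open>'a\<close>, whose inner
  product is the given one, together with a bracket \<open>br\<close>.
\<close>

definition lie_bracket :: "('a::euclidean_space \<Rightarrow> 'a \<Rightarrow> 'a) \<Rightarrow> bool" where
  "lie_bracket br \<longleftrightarrow>
     bilinear br \<and>
     (\<forall>x. br x x = 0) \<and>
     (\<forall>x y z. br x (br y z) + br y (br z x) + br z (br x y) = 0)"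

definition lie_ideal :: "('a::euclidean_space \<Rightarrow> 'a \<Rightarrow> 'a) \<Rightarrow> 'a set \<Rightarrow> bool" where
  "lie_ideal br I \<longleftrightarrow> subspace I \<and> (\<forall>x. \<forall>y\<in>I. br x y \<in> I)"

definition almost_abelian :: "('a::euclidean_space \<Rightarrow> 'a \<Rightarrow> 'a) \<Rightarrow> bool" where
  "almost_abelian br \<longleftrightarrow>
     (\<exists>I. lie_ideal br I \<and> (\<forall>x\<in>I. \<forall>y\<in>I. br x y = 0) \<and> dim I + 1 = DIM('a))"

text \<open>The vector determined by the Koszul formula; it exists by bilinearity of the bracket.\<close>

definition levi_civita :: "('a::euclidean_space \<Rightarrow> 'a \<Rightarrow> 'a) \<Rightarrow> 'a \<Rightarrow> 'a \<Rightarrow> 'a" where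
  "levi_civita br x y =
     (THE v. \<forall>z. 2 * (v \<bullet> z) = br x y \<bullet> z - br y z \<bullet> x + br z x \<bullet> y)"

lemma levi_civita_koszul:
  fixes br :: "'a::euclidean_space \<Rightarrow> 'a \<Rightarrow> 'a"
  assumes "bilinear br"
  shows "2 * (levi_civita br x y \<bullet> z) = br x y \<bullet> z - br y z \<bullet> x + br z x \<bullet> y"
proof -
  define f where "f z = (br x y \<bullet> z - br y z \<bullet> x + br z x \<bullet> y) / 2" for z
  have lin: "linear f"
    unfolding f_def
    by (rule linearI)
       (simp_all add: bilinear_ladd[OF assms] bilinear_radd[OF assms] bilinear_lmul[OF assms]
          bilinear_rmul[OF assms] inner_simps field_simps)
  define v where "v = (\<Sum>b\<in>Basis. f b *\<^sub>R b)"
  have fv: "v \<bullet> z = f z" for z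
  proof -
    have "f z = f (\<Sum>b\<in>Basis. (z \<bullet> b) *\<^sub>R b)"
      by (simp add: euclidean_representation)
    also have "\<dots> = (\<Sum>b\<in>Basis. (z \<bullet> b) * f b)"
      by (simp add: linear_sum[OF lin] linear_cmul[OF lin])
    finally show ?thesis
      by (simp add: v_def inner_sum_left inner_commute[of z] mult.commute)
  qed
  have "\<forall>z. 2 * (levi_civita br x y \<bullet> z) = br x y \<bullet> z - br y z \<bullet> x + br z x \<bullet> y"
    unfolding levi_civita_def
  proof (rule theI)
    show "\<forall>z. 2 * (v \<bullet> z) = br x y \<bullet> z - br y z \<bullet> x + br z x \<bullet> y"
      by (simp add: fv f_def)
    show "w = v" if "\<forall>z. 2 * (w \<bullet> z) = br x y \<bullet> z - br y z \<bullet> x + br z x \<bullet> y" for w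
      by (rule vector_eq_rdot[THEN iffD1]) (use that in \<open>simp add: fv f_def field_simps\<close>)
  qed
  then show ?thesis by blast
qed

text \<open>
  A \<open>p\<close>-form is a function of the list of its \<open>p\<close> arguments.  It is normalised to be \<open>0\<close> on lists
  of any other length, so that equality of \<open>p\<close>-forms is equality of functions; the operations below
  preserve this normalisation.
\<close>

definition alt_form :: "nat \<Rightarrow> ('a::euclidean_space list \<Rightarrow> real) \<Rightarrow> bool" where
  "alt_form p \<omega> \<longleftrightarrow>
     (\<forall>xs. length xs \<noteq> p \<longrightarrow> \<omega> xs = 0) \<and>
     (\<forall>xs i. length xs = p \<longrightarrow> i < p \<longrightarrow> linear (\<lambda>v. \<omega> (xs[i := v]))) \<and>
     (\<forall>xs i j. length xs = p \<longrightarrow> i < j \<longrightarrow> j < p \<longrightarrow> xs ! i = xs ! j \<longrightarrow> \<omega> xs = 0)"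

definition cov_deriv ::
  "('a::euclidean_space \<Rightarrow> 'a \<Rightarrow> 'a) \<Rightarrow> 'a \<Rightarrow> ('a list \<Rightarrow> real) \<Rightarrow> 'a list \<Rightarrow> real" where
  "cov_deriv br x \<omega> xs = - (\<Sum>i<length xs. \<omega> (xs[i := levi_civita br x (xs ! i)]))"

text \<open>\<open>nths xs (- S)\<close> is \<open>xs\<close> with the entries at the positions in \<open>S\<close> omitted (counted from \<open>0\<close>).\<close>

definition ext_deriv ::
  "('a::euclidean_space \<Rightarrow> 'a \<Rightarrow> 'a) \<Rightarrow> ('a list \<Rightarrow> real) \<Rightarrow> 'a list \<Rightarrow> real" where
  "ext_deriv br \<omega> xs =
     (\<Sum>j<length xs. \<Sum>i<j. (-1) ^ (i + j) * \<omega> (br (xs ! i) (xs ! j) # nths xs (- {i, j})))"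

definition interior_prod :: "'a::euclidean_space \<Rightarrow> ('a list \<Rightarrow> real) \<Rightarrow> 'a list \<Rightarrow> real" where
  "interior_prod x \<omega> xs = \<omega> (x # xs)"

text \<open>
  The exterior product of a 1-form \<open>\<alpha>\<close>, given as a function on vectors, with a form \<open>\<beta>\<close>, in the
  normalisation \<open>(\<alpha>\<^sub>1 \<and> \<dots> \<and> \<alpha>\<^sub>k)(x\<^sub>1, \<dots>, x\<^sub>k) = det (\<alpha>\<^sub>i x\<^sub>j)\<close>, the one compatible with
  \<open>ext_deriv\<close>.
\<close>

definition wedge1 ::
  "('a::euclidean_space \<Rightarrow> real) \<Rightarrow> ('a list \<Rightarrow> real) \<Rightarrow> 'a list \<Rightarrow> real" where
  "wedge1 \<alpha> \<beta> xs = (\<Sum>i<length xs. (-1) ^ i * \<alpha> (xs ! i) * \<beta> (nths xs (- {i})))"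

text \<open>\<open>Basis\<close> is an orthonormal basis; the trace does not depend on which one is used.\<close>

definition codiff ::
  "('a::euclidean_space \<Rightarrow> 'a \<Rightarrow> 'a) \<Rightarrow> ('a list \<Rightarrow> real) \<Rightarrow> 'a list \<Rightarrow> real" where
  "codiff br \<omega> xs = - (\<Sum>e\<in>Basis. interior_prod e (cov_deriv br e \<omega>) xs)"

definition conformal_killing ::
  "('a::euclidean_space \<Rightarrow> 'a \<Rightarrow> 'a) \<Rightarrow> nat \<Rightarrow> ('a list \<Rightarrow> real) \<Rightarrow> bool" where
  "conformal_killing br p \<omega> \<longleftrightarrow>
     alt_form p \<omega> \<and>
     (\<forall>x xs. cov_deriv br x \<omega> xs =
        1 / (real p + 1) * interior_prod x (ext_deriv br \<omega>) xs
        - 1 / (real DIM('a) - real p + 1) * wedge1 (\<lambda>y. x \<bullet> y) (codiff br \<omega>) xs)"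

definition parallel_form ::
  "('a::euclidean_space \<Rightarrow> 'a \<Rightarrow> 'a) \<Rightarrow> ('a list \<Rightarrow> real) \<Rightarrow> bool" where
  "parallel_form br \<omega> \<longleftrightarrow> (\<forall>x xs. cov_deriv br x \<omega> xs = 0)"

end

theory Submission
  imports Defs
begin

text \<open>
  Let \<open>u\<close> be a unit normal of the abelian ideal \<open>I\<close> and \<open>S x = - \<nabla>\<^sub>x u\<close>.  The Koszul formula shows
  that \<open>S\<close> is a symmetric endomorphism of \<open>I\<close>, that \<open>\<nabla>\<^sub>x y = \<langle>S x, y\<rangle> u\<close> for \<open>x, y\<close> in \<open>I\<close>, and that
  \<open>\<nabla>\<^sub>u\<close> kills \<open>u\<close> and acts on \<open>I\<close> by a skew endomorphism.  Choose an orthonormal eigenbasis \<open>E\<close> of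
  \<open>S\<close> on \<open>I\<close>, with eigenvalues \<open>lam e\<close> (\<open>almost_abelian_adapted_frame\<close>).

  The conformal Killing equation is used only through two consequences
  (\<open>conformal_killing_polarized\<close>): if \<open>L\<close> is a list of vectors orthogonal to \<open>x\<close> and \<open>y\<close>, then
  \<open>(\<nabla>\<^sub>x \<omega>)(y, L)\<close> is skew in \<open>x, y\<close> when \<open>x\<close> and \<open>y\<close> are orthogonal, and \<open>(\<nabla>\<^sub>x \<omega>)(x, L)\<close> is the same
  for all such \<open>x\<close> of a given length.  Comparing \<open>x = u\<close> with \<open>y\<close> in \<open>E\<close>, where \<open>\<nabla>\<^sub>y\<close> is explicit, gives
  for every list \<open>L\<close> over \<open>E\<close>
    \<^item> \<open>(\<nabla>\<^sub>u \<omega>)(L) = - lam f \<omega>(L)\<close> for every \<open>f\<close> occurring in \<open>L\<close>,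
    \<^item> \<open>(\<nabla>\<^sub>u \<omega>)(u, L) = - lam f \<omega>(u, L)\<close> for every \<open>f\<close> in \<open>E\<close> not occurring in \<open>L\<close>.

  So the components of \<open>\<omega>\<close> are multiplied by eigenvalues, while \<open>\<nabla>\<^sub>u\<close> is a skew operator on forms.
  Its matrix entries connect only components that differ in one slot.  If \<open>p \<ge> 2\<close>, two lists of
  length \<open>p\<close> that differ in one slot have a common member; if \<open>p \<le> n - 2\<close>, two lists of length
  \<open>p - 1\<close> over \<open>E\<close> that differ in one slot miss a common member of \<open>E\<close>.  So both components have the
  same multiplier, and skewness makes the sum of the squares of the components of \<open>\<nabla>\<^sub>u \<omega>\<close> vanish
  (\<open>skew_derivation_eigen_zero\<close>).  The displayed equations then say that \<open>lam f \<omega>(L)\<close> and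
  \<open>lam f \<omega>(u, L)\<close> vanish in the respective cases, and these are the only components of \<open>\<nabla>\<^sub>f \<omega>\<close>.
  Forms of top degree are parallel because \<open>\<nabla>\<^sub>x\<close> is skew, hence of trace zero; this gives the
  second part of the theorem.
\<close>

section \<open>Alternating forms\<close>

lemma alt_form_length: "alt_form p \<omega> \<Longrightarrow> length xs \<noteq> p \<Longrightarrow> \<omega> xs = 0"
  by (simp add: alt_form_def)

lemma alt_form_linear: "alt_form p \<omega> \<Longrightarrow> linear (\<lambda>v. \<omega> (xs[i := v]))"
  if "i < length xs"
proof (cases "length xs = p")
  case False
  moreover assume "alt_form p \<omega>"
  ultimately have "(\<lambda>v. \<omega> (xs[i := v])) = (\<lambda>v. 0)"
    by (simp add: alt_form_length)
  then show ?thesis by (simp add: linear_iff)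
qed (use that in \<open>simp add: alt_form_def\<close>)

lemma alt_form_repeated:
  assumes "alt_form p \<omega>" "i < length xs" "j < length xs" "i \<noteq> j" "xs ! i = xs ! j"
  shows "\<omega> xs = 0"
  using assms unfolding alt_form_def by (metis linorder_neqE_nat)

lemma alt_form_not_distinct: "alt_form p \<omega> \<Longrightarrow> \<not> distinct xs \<Longrightarrow> \<omega> xs = 0"
  by (meson alt_form_repeated distinct_conv_nth)

text \<open>Expand \<open>0 = B(a + b, a + b)\<close> for the bilinear dependence \<open>B\<close> on the two slots.\<close>

lemma alt_form_swap:
  assumes \<omega>: "alt_form p \<omega>" and ij: "i < length xs" "j < length xs" "i \<noteq> j"
  shows "\<omega> (xs[i := xs ! j, j := xs ! i]) = - \<omega> xs"
proof -
  define B where "B v w = \<omega> (xs[i := v, j := w])" for v w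
  have right: "linear (B v)" for v
    unfolding B_def using alt_form_linear[OF _ \<omega>, of j "xs[i := v]"] ij by simp
  have left: "linear (\<lambda>v. B v w)" for w
    unfolding B_def list_update_swap[OF ij(3)]
    using alt_form_linear[OF _ \<omega>, of i "xs[j := w]"] ij by simp
  have diag: "B v v = 0" for v
    unfolding B_def by (rule alt_form_repeated[OF \<omega>, of i _ j]) (use ij in auto)
  define a where "a = xs ! i"
  define b where "b = xs ! j"
  have "B (a + b) (a + b) = B a a + B a b + (B b a + B b b)"
    by (simp add: linear_add[OF left] linear_add[OF right])
  then have "B b a = - B a b"
    by (simp add: diag)
  then show ?thesis
    by (simp add: B_def a_def b_def)
qed

lemma alt_form_add:
  assumes "alt_form p \<phi>" "alt_form p \<psi>"
  shows "alt_form p (\<lambda>xs. \<phi> xs + c * \<psi> xs)"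
proof -
  have "linear (\<lambda>v. \<phi> (xs[i := v]) + c * \<psi> (xs[i := v]))" if "i < length xs" for xs i
    using alt_form_linear[OF that assms(1)] alt_form_linear[OF that assms(2)]
    by (simp add: linear_iff algebra_simps)
  then show ?thesis
    using assms unfolding alt_form_def by simp
qed

lemma alt_form_update_sum:
  assumes "alt_form p \<omega>" "k < length xs"
  shows "\<omega> (xs[k := (\<Sum>e\<in>E. c e *\<^sub>R e)]) = (\<Sum>e\<in>E. c e * \<omega> (xs[k := e]))"
  using linear_sum[OF alt_form_linear[OF assms(2,1)], of "\<lambda>e. c e *\<^sub>R e" E]
  by (simp add: linear_cmul[OF alt_form_linear[OF assms(2,1)]])

lemma alt_form_update_scale:
  assumes "alt_form p \<omega>" "k < length xs"
  shows "\<omega> (xs[k := c *\<^sub>R v]) = c * \<omega> (xs[k := v])"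
  using linear_cmul[OF alt_form_linear[OF assms(2,1)], of c v] by simp

lemma alt_form_update_zero:
  assumes "alt_form p \<omega>" "k < length xs"
  shows "\<omega> (xs[k := 0]) = 0"
  using alt_form_linear[OF assms(2,1)] by (rule linear_0)

text \<open>
  A transposition moves \<open>b\<close> to the front.  This allows the covariant derivative to be computed only
  on lists that start with the interesting vector, without tracking signs.
\<close>

lemma alt_form_zero_if_leading:
  assumes \<omega>: "alt_form p \<omega>" and "b \<in> set xs"
    and lead: "\<And>ys. distinct (b # ys) \<Longrightarrow> set (b # ys) = set xs \<Longrightarrow> length (b # ys) = length xs
                 \<Longrightarrow> \<omega> (b # ys) = 0"
  shows "\<omega> xs = 0"
proof (cases "distinct xs")
  case False
  then show ?thesis using \<omega> by (rule alt_form_not_distinct[rotated])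
next
  case True
  obtain j where j: "j < length xs" "xs ! j = b"
    using assms(2) by (auto simp: in_set_conv_nth)
  define zs where "zs = xs[0 := xs ! j, j := xs ! 0]"
  have zs: "distinct zs" "set zs = set xs" "length zs = length xs"
    using distinct_swap[of 0 xs j] set_swap[of 0 xs j] j True
    unfolding zs_def by (auto simp del: length_greater_0_conv)
  have "0 < length xs"
    using j by linarith
  then have "zs ! 0 = b"
    using j by (cases "j = 0") (auto simp: zs_def)
  then have "zs = b # tl zs"
    using zs(3) j by (cases zs) auto
  then have "\<omega> zs = 0"
    using lead[of "tl zs"] zs by metis
  moreover have "\<omega> zs = - \<omega> xs \<or> zs = xs"
    using alt_form_swap[OF \<omega> \<open>0 < length xs\<close> j(1)] by (cases "j = 0") (auto simp: zs_def)
  ultimately show ?thesis by auto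
qed

text \<open>
  By linearity in each slot, the arguments from the spanning set can be replaced by arbitrary vectors
  one slot at a time.
\<close>

lemma alt_form_zero_if_spanning:
  assumes \<omega>: "alt_form p \<omega>" and B: "span B = UNIV"
    and zero: "\<And>xs. distinct xs \<Longrightarrow> set xs \<subseteq> B \<Longrightarrow> length xs = p \<Longrightarrow> \<omega> xs = 0"
  shows "\<omega> xs = 0"
proof (cases "length xs = p")
  case False
  then show ?thesis by (rule alt_form_length[OF \<omega>])
next
  case True
  \<comment> \<open>the slots below \<open>k\<close> are already arbitrary\<close>
  have "\<omega> ys = 0" if "k \<le> p" "length ys = p" "\<And>i. k \<le> i \<Longrightarrow> i < p \<Longrightarrow> ys ! i \<in> B" for k ys
    using that
  proof (induction k arbitrary: ys)
    case 0
    then have "set ys \<subseteq> B" by (auto simp: in_set_conv_nth)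
    then show ?case
      using zero 0 alt_form_not_distinct[OF \<omega>] by blast
  next
    case (Suc k)
    have "\<omega> (ys[k := v]) = 0" if "v \<in> B" for v
    proof (rule Suc.IH)
      show "ys[k := v] ! i \<in> B" if "k \<le> i" "i < p" for i
        using that \<open>v \<in> B\<close> Suc.prems by (cases "i = k") auto
    qed (use Suc.prems in auto)
    then have "\<omega> (ys[k := ys ! k]) = 0"
      using linear_eq_0_on_span[OF alt_form_linear[OF _ \<omega>, of k ys], of B "ys ! k"] Suc.prems B
      by auto
    then show ?case by simp
  qed
  from this[of p xs] True show ?thesis by simp
qed

section \<open>Covariant and exterior derivative\<close>

lemma lie_bracket_skew:
  assumes "lie_bracket br"
  shows "br x y = - br y x"
proof -
  have b: "bilinear br" and z: "\<And>x. br x x = 0"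
    using assms by (auto simp: lie_bracket_def)
  have "br (x + y) (x + y) = br x y + br y x"
    unfolding bilinear_ladd[OF b] bilinear_radd[OF b] by (simp add: z)
  then have "br x y + br y x = 0" by (simp only: z)
  then show ?thesis by (rule eq_neg_iff_add_eq_0[THEN iffD2])
qed

lemma levi_civita_skew:
  assumes "lie_bracket br"
  shows "levi_civita br x y \<bullet> z = - (levi_civita br x z \<bullet> y)"
proof -
  have b: "bilinear br" using assms by (simp add: lie_bracket_def)
  have s: "br x z = - br z x" "br y x = - br x y" "br z y = - br y z"
    by (rule lie_bracket_skew[OF assms])+
  show ?thesis
    using levi_civita_koszul[OF b, of x y z] levi_civita_koszul[OF b, of x z y]
    unfolding s by (simp add: algebra_simps)
qed

lemma linear_levi_civita:
  assumes b: "bilinear br"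
  shows "linear (levi_civita br x)" "linear (\<lambda>x. levi_civita br x y)"
proof -
  have double: "2 * (c * (levi_civita br x y \<bullet> z)) = c * (2 * (levi_civita br x y \<bullet> z))" for c x y z
    by simp
  note simps = double inner_add_left distrib_left levi_civita_koszul[OF b] bilinear_ladd[OF b]
    bilinear_radd[OF b] bilinear_lmul[OF b] bilinear_rmul[OF b] inner_add_right inner_scaleR_left
    inner_scaleR_right
  have "2 * (levi_civita br x (v + w) \<bullet> z) = 2 * ((levi_civita br x v + levi_civita br x w) \<bullet> z)"
    "2 * (levi_civita br x (c *\<^sub>R v) \<bullet> z) = 2 * ((c *\<^sub>R levi_civita br x v) \<bullet> z)"
    "2 * (levi_civita br (v + w) y \<bullet> z) = 2 * ((levi_civita br v y + levi_civita br w y) \<bullet> z)"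
    "2 * (levi_civita br (c *\<^sub>R v) y \<bullet> z) = 2 * ((c *\<^sub>R levi_civita br v y) \<bullet> z)"
    for x y v w z c
    unfolding simps by (simp_all only: algebra_simps)
  note koszul_linear = this
  have eqI: "v = w" if "\<And>z. 2 * (v \<bullet> z) = 2 * (w \<bullet> z)" for v w :: 'a
    using that by (intro vector_eq_rdot[THEN iffD1]) simp
  show "linear (levi_civita br x)" "linear (\<lambda>x. levi_civita br x y)"
    by (rule linearI; rule eqI; rule koszul_linear)+
qed

lemma alt_form_cov_deriv:
  assumes b: "bilinear br" and \<omega>: "alt_form p \<omega>"
  shows "alt_form p (cov_deriv br x \<omega>)"
  unfolding alt_form_def
proof (intro conjI allI impI)
  let ?N = "levi_civita br x"
  fix xs :: "'a list" and i :: nat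
  show "cov_deriv br x \<omega> xs = 0" if "length xs \<noteq> p"
    using that by (simp add: cov_deriv_def alt_form_length[OF \<omega>])
  show "linear (\<lambda>v. cov_deriv br x \<omega> (xs[i := v]))" if "length xs = p" "i < p"
  proof -
    have "linear (\<lambda>v. \<omega> (xs[i := v, k := ?N (xs[i := v] ! k)]))" if "k < p" for k
    proof (cases "k = i")
      case True
      have "linear (\<lambda>v. \<omega> (xs[i := ?N v]))"
        using linear_compose[OF linear_levi_civita(1)[OF b] alt_form_linear[OF _ \<omega>, of i xs]]
          \<open>length xs = p\<close> \<open>i < p\<close> by (simp add: o_def)
      then show ?thesis using True \<open>length xs = p\<close> \<open>i < p\<close> by simp
    next
      case False
      have "linear (\<lambda>v. \<omega> (xs[k := ?N (xs ! k), i := v]))"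
        by (rule alt_form_linear[OF _ \<omega>]) (use \<open>length xs = p\<close> \<open>i < p\<close> in simp)
      then show ?thesis using False by (simp add: list_update_swap[of k i])
    qed
    then show ?thesis
      unfolding cov_deriv_def length_list_update using that
      by (intro linear_compose_neg linear_compose_sum) auto
  qed
  fix j :: nat
  assume h: "length xs = p" "i < j" "j < p" "xs ! i = xs ! j"
  have "(\<Sum>k<p. \<omega> (xs[k := ?N (xs ! k)])) = (\<Sum>k\<in>{i, j}. \<omega> (xs[k := ?N (xs ! k)]))"
  proof (rule sum.mono_neutral_right)
    show "\<forall>k\<in>{..<p} - {i, j}. \<omega> (xs[k := ?N (xs ! k)]) = 0"
      using h by (auto intro!: alt_form_repeated[OF \<omega>, of i _ j])
  qed (use h in auto)
  \<comment> \<open>only the slots \<open>i\<close> and \<open>j\<close> contribute, and a transposition exchanges their contributions\<close>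
  moreover have "\<omega> (xs[j := ?N (xs ! j)]) = - \<omega> (xs[i := ?N (xs ! i)])"
  proof -
    define ys where "ys = xs[i := ?N (xs ! i)]"
    have "ys[i := ys ! j, j := ys ! i] = xs[j := ?N (xs ! j)]"
      using h by (simp add: ys_def list_update_swap[of j i])
        (metis list_update_id)
    then show ?thesis
      using alt_form_swap[OF \<omega>, of i ys j] h by (simp add: ys_def)
  qed
  ultimately show "cov_deriv br x \<omega> xs = 0"
    using h by (simp add: cov_deriv_def)
qed

lemma nths_drop_index_0: "nths (x # xs) (- {0}) = xs"
proof -
  have "nths xs {j. Suc j \<in> - {0}} = xs" by (rule nths_all) simp
  then show ?thesis by (simp add: nths_Cons)
qed

text \<open>
  Exchanging the first two arguments
  negates the term of the pair \<open>(0, 1)\<close> by skewness of the bracket, exchanges the terms of \<open>(0, j)\<close> and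
  \<open>(1, j)\<close> for \<open>j \<ge> 2\<close> up to sign, and negates all others by alternation of \<open>\<omega>\<close>.
\<close>

lemma ext_deriv_swap:
  assumes "lie_bracket br" and \<omega>: "alt_form p \<omega>"
  shows "ext_deriv br \<omega> (x # y # L) = - ext_deriv br \<omega> (y # x # L)"
proof -
  let ?G = "\<lambda>xs i j. (-1) ^ (i + j) * \<omega> (br (xs ! i) (xs ! j) # nths xs (- {i, j}))"
  have b: "bilinear br" using assms(1) by (simp add: lie_bracket_def)
  have del: "nths (x # y # L) (- {0, Suc 0}) = L"
    "nths (x # y # L) (- {0, Suc (Suc j)}) = y # nths L (- {j})"
    "nths (x # y # L) (- {Suc 0, Suc (Suc j)}) = x # nths L (- {j})"
    "nths (x # y # L) (- {Suc (Suc i), Suc (Suc j)}) = x # y # nths L (- {i, j})" for x y i j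
    by (simp_all add: nths_Cons Compl_eq nths_all)
  define R where "R xs j = ?G xs 0 (Suc (Suc j)) + (?G xs 1 (Suc (Suc j))
    + (\<Sum>i<j. ?G xs (Suc (Suc i)) (Suc (Suc j))))" for xs j
  have split: "ext_deriv br \<omega> (x # y # L) = ?G (x # y # L) 0 1 + (\<Sum>j<length L. R (x # y # L) j)" for x y
    unfolding ext_deriv_def R_def
    by (simp add: sum.lessThan_Suc_shift algebra_simps del: sum.lessThan_Suc)
  have neg1: "\<omega> (- v # zs) = - \<omega> (v # zs)" for v zs
    using linear_neg[OF alt_form_linear[OF _ \<omega>, of 0 "v # zs"]] by simp
  have sw: "\<omega> (v # x # y # zs) = - \<omega> (v # y # x # zs)" for v x y zs
    using alt_form_swap[OF \<omega>, of 1 "v # y # x # zs" 2] by (simp add: numeral_2_eq_2)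
  have "?G (x # y # L) 0 1 = - ?G (y # x # L) 0 1"
    using neg1[of "br y x" L] lie_bracket_skew[OF assms(1), of x y] by (simp add: del)
  moreover have "R (x # y # L) j = - R (y # x # L) j" for j
  proof -
    have "?G (x # y # L) 0 (Suc (Suc j)) = - ?G (y # x # L) 1 (Suc (Suc j))"
      "?G (x # y # L) 1 (Suc (Suc j)) = - ?G (y # x # L) 0 (Suc (Suc j))"
      by (simp_all add: del)
    moreover have "?G (x # y # L) (Suc (Suc i)) (Suc (Suc j))
        = - ?G (y # x # L) (Suc (Suc i)) (Suc (Suc j))" for i
      using sw[of _ x y] by (simp add: del)
    ultimately show ?thesis
      unfolding R_def by (simp only: sum_negf)
  qed
  then have "(\<Sum>j<length L. R (x # y # L) j) = - (\<Sum>j<length L. R (y # x # L) j)"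
    by (simp add: sum_negf)
  ultimately show ?thesis
    unfolding split by (simp only: minus_add_distrib)
qed

lemma wedge1_Cons_orthogonal:
  assumes "\<And>v. v \<in> set L \<Longrightarrow> \<alpha> v = 0"
  shows "wedge1 \<alpha> \<tau> (y # L) = \<alpha> y * \<tau> L"
proof -
  have "wedge1 \<alpha> \<tau> (y # L) = (\<Sum>i<Suc (length L). if i = 0 then \<alpha> y * \<tau> L else 0)"
    unfolding wedge1_def
  proof (intro sum.cong)
    fix i assume "i \<in> {..<Suc (length L)}"
    then show "(-1) ^ i * \<alpha> ((y # L) ! i) * \<tau> (nths (y # L) (- {i})) = (if i = 0 then \<alpha> y * \<tau> L else 0)"
      using assms by (cases i) (auto simp: nths_drop_index_0)
  qed simp
  then show ?thesis by simp
qed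


text \<open>
  On \<open>(y, L)\<close> the exterior product \<open>x\<^sup>* \<and> d\<^sup>*\<omega>\<close> reduces to \<open>\<langle>x, y\<rangle> d\<^sup>*\<omega>(L)\<close>, as \<open>x\<close> is orthogonal to \<open>L\<close>,
  and \<open>d\<omega>(x, y, L)\<close> is skew in \<open>x, y\<close>.  Hence the symmetric part of \<open>(\<nabla>\<^sub>x \<omega>)(y, L)\<close> is a multiple of the
  inner product, with a factor that depends on \<open>L\<close> only.
\<close>

lemma conformal_killing_polarized:
  assumes br: "lie_bracket br" and ck: "conformal_killing br p \<omega>"
    and L: "\<And>v. v \<in> set L \<Longrightarrow> x \<bullet> v = 0" "\<And>v. v \<in> set L \<Longrightarrow> y \<bullet> v = 0"
  shows "x \<bullet> y = 0 \<Longrightarrow> cov_deriv br x \<omega> (y # L) = - cov_deriv br y \<omega> (x # L)"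
    and "norm x = norm y \<Longrightarrow> cov_deriv br x \<omega> (x # L) = cov_deriv br y \<omega> (y # L)"
proof -
  define c where "c = 1 / (real p + 1)"
  define d where "d = 1 / (real DIM('a) - real p + 1)"
  have \<omega>: "alt_form p \<omega>" using ck by (simp add: conformal_killing_def)
  have eq: "cov_deriv br v \<omega> (w # L) = c * ext_deriv br \<omega> (v # w # L) - d * ((v \<bullet> w) * codiff br \<omega> L)"
    if "v \<in> {x, y}" for v w
    using ck L that wedge1_Cons_orthogonal[of L "\<lambda>w. v \<bullet> w" "codiff br \<omega>" w]
    by (auto simp: conformal_killing_def interior_prod_def c_def d_def)
  note sw = ext_deriv_swap[OF br \<omega>]
  show "cov_deriv br x \<omega> (y # L) = - cov_deriv br y \<omega> (x # L)" if "x \<bullet> y = 0"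
    using eq[of x y] eq[of y x] sw[of x y L] that by (simp add: inner_commute)
  show "cov_deriv br x \<omega> (x # L) = cov_deriv br y \<omega> (y # L)" if "norm x = norm y"
    using eq[of x x] eq[of y y] sw[of x x L] sw[of y y L] that by (simp add: dot_square_norm)
qed

section \<open>Skew derivations\<close>

text \<open>
  \<open>F\<close> is the image of the form \<open>\<gamma>\<close> under the derivation induced by a skew matrix \<open>a\<close>, written on lists of
  basis vectors.  The last hypothesis on \<open>F\<close> says that lists differing in one slot have the same
  eigenvalue \<open>F L / \<gamma> L\<close>, without dividing by \<open>\<gamma> L\<close>, which may be \<open>0\<close>.  Expanding one factor of \<open>F L\<close>
  in the sum of all \<open>(F L)\<^sup>2\<close> gives a sum over triples \<open>(L, k, e)\<close>.  The involution that exchanges \<open>L\<close>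
  with \<open>L[k := e]\<close> reverses the sign of each summand, so that the sum of squares is \<open>0\<close>.
\<close>

lemma skew_derivation_eigen_zero:
  fixes a :: "'b \<Rightarrow> 'b \<Rightarrow> real" and \<gamma> F :: "'b list \<Rightarrow> real"
  assumes E: "finite E" and skew: "\<And>e f. a e f = - a f e"
    and F: "\<And>L. set L \<subseteq> E \<Longrightarrow> length L = q \<Longrightarrow>
              F L = (\<Sum>k<q. \<Sum>e\<in>E. a e (L ! k) * \<gamma> (L[k := e]))"
    and nbr: "\<And>L k e. set L \<subseteq> E \<Longrightarrow> length L = q \<Longrightarrow> k < q \<Longrightarrow> e \<in> E \<Longrightarrow>
              F L * \<gamma> (L[k := e]) = F (L[k := e]) * \<gamma> L"
    and L: "set L \<subseteq> E" "length L = q"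
  shows "F L = 0"
proof -
  define X where "X = {L. set L \<subseteq> E \<and> length L = q}"
  have X: "finite X"
    unfolding X_def by (rule finite_lists_length_eq[OF E])
  define T where "T = (\<lambda>(L, k, e). F L * (a e (L ! k) * \<gamma> (L[k := e])))"
  let ?I = "X \<times> {..<q} \<times> E"
  let ?\<phi> = "\<lambda>(L, k, e). (L[k := e], k, L ! k)"
  have "(\<Sum>L\<in>X. (F L)\<^sup>2) = (\<Sum>L\<in>X. \<Sum>k<q. \<Sum>e\<in>E. T (L, k, e))"
    unfolding power2_eq_square
    by (rule sum.cong) (simp_all add: T_def X_def F sum_distrib_left)
  also have "\<dots> = sum T ?I"
    by (simp add: sum.cartesian_product)
  finally have sq: "(\<Sum>L\<in>X. (F L)\<^sup>2) = sum T ?I" .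
  have mem: "?\<phi> t \<in> ?I" "?\<phi> (?\<phi> t) = t" if "t \<in> ?I" for t
    using that by (auto simp: X_def dest!: set_update_subset_insert[THEN subsetD])
  have "sum T ?I = (\<Sum>t\<in>?I. - T t)"
  proof (rule sum.reindex_bij_witness[of ?I ?\<phi> ?\<phi>])
    fix t assume t: "t \<in> ?I"
    obtain L k e where [simp]: "t = (L, k, e)" by (cases t)
    have "T (?\<phi> t) = F (L[k := e]) * (a (L ! k) e * \<gamma> L)"
      using t by (simp add: T_def X_def)
    also have "\<dots> = - (a e (L ! k) * (F (L[k := e]) * \<gamma> L))"
      by (subst skew) simp
    also have "\<dots> = - T t"
      using t nbr[of L k e] by (simp add: T_def X_def)
    finally show "- T (?\<phi> t) = T t" by simp
  qed (use mem in auto)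
  then have "sum T ?I = 0"
    by (simp add: sum_negf)
  then have "\<forall>L\<in>X. (F L)\<^sup>2 = 0"
    using sum_nonneg_eq_0_iff[OF X, of "\<lambda>L. (F L)\<^sup>2"] sq by simp
  then show ?thesis
    using L by (simp add: X_def)
qed

section \<open>Diagonalisation\<close>

text \<open>
  A maximiser \<open>v\<close> of the quadratic form on the unit sphere of \<open>V\<close> is an eigenvector: the first variation
  of \<open>\<langle>S v, v\<rangle>\<close> in any direction \<open>w\<close> orthogonal to \<open>v\<close> vanishes, so \<open>S v\<close> is orthogonal to all these \<open>w\<close>.
\<close>

lemma symmetric_eigenvector:
  fixes S :: "'a::euclidean_space \<Rightarrow> 'a"
  assumes S: "linear S" and V: "subspace V" "V \<noteq> {0}" and inv: "\<And>v. v \<in> V \<Longrightarrow> S v \<in> V"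
    and sym: "\<And>v w. v \<in> V \<Longrightarrow> w \<in> V \<Longrightarrow> S v \<bullet> w = S w \<bullet> v"
  obtains v c where "v \<in> V" "norm v = 1" "S v = c *\<^sub>R v"
proof -
  let ?K = "sphere 0 1 \<inter> V"
  obtain w where w: "w \<in> V" "w \<noteq> 0"
    using V subspace_0[OF V(1)] by auto
  have "compact ?K"
    by (intro compact_Int_closed compact_sphere closed_subspace V)
  moreover have "w /\<^sub>R norm w \<in> ?K"
    using w V by (auto simp: subspace_scale)
  moreover have "continuous_on ?K (\<lambda>v. S v \<bullet> v)"
    by (intro continuous_intros linear_continuous_on_compose[OF _ S])
  ultimately obtain v where v: "v \<in> ?K" and max: "\<And>u. u \<in> ?K \<Longrightarrow> S u \<bullet> u \<le> S v \<bullet> v"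
    using continuous_attains_sup[of ?K "\<lambda>v. S v \<bullet> v"] by blast
  define c where "c = S v \<bullet> v"
  have vV: "v \<in> V" and v1: "v \<bullet> v = 1"
    using v by (auto simp: dot_square_norm)
  have bound: "S u \<bullet> u \<le> c * (u \<bullet> u)" if "u \<in> V" for u
  proof (cases "u = 0")
    case False
    define r where "r = norm u"
    have r: "r > 0" "u \<bullet> u = r\<^sup>2" using False by (auto simp: r_def dot_square_norm)
    have "u /\<^sub>R r \<in> ?K"
      using that V False by (auto simp: subspace_scale r_def)
    from max[OF this] have "(S u \<bullet> u) / r\<^sup>2 \<le> c"
      by (simp add: c_def linear_cmul[OF S] power2_eq_square divide_inverse mult_ac)
    then show ?thesis
      using r by (simp add: field_simps)
  qed (simp add: linear_0[OF S])
  have orth: "S v \<bullet> w = 0" if "w \<in> V" "v \<bullet> w = 0" for w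
  proof (rule ccontr)
    assume nz: "S v \<bullet> w \<noteq> 0"
    \<comment> \<open>\<open>t\<close> is so small that in the direction \<open>w\<close> the linear term \<open>2 t g\<close> beats the quadratic one\<close>
    define g where "g = S v \<bullet> w"
    define h where "h = \<bar>c * (w \<bullet> w) - S w \<bullet> w\<bar> + 1"
    define t where "t = g / h"
    have "h > 0" "t \<noteq> 0" using nz by (auto simp: h_def t_def g_def)
    have "v + t *\<^sub>R w \<in> V"
      using vV that V by (auto intro: subspace_add subspace_scale)
    from bound[OF this] have "2 * t * g \<le> t\<^sup>2 * (c * (w \<bullet> w) - S w \<bullet> w)"
      using that vV v1 sym[of w v]
      by (simp add: linear_add[OF S] linear_cmul[OF S] inner_simps c_def g_def algebra_simps
            power2_eq_square inner_commute)
    also have "\<dots> \<le> t\<^sup>2 * h"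
      by (rule mult_left_mono) (auto simp: h_def)
    also have "\<dots> = t * g"
      using \<open>h > 0\<close> by (simp add: t_def power2_eq_square)
    finally have "t * g \<le> 0" by (simp add: mult.commute)
    moreover have "t * g = g\<^sup>2 / h" by (simp add: t_def power2_eq_square)
    ultimately show False
      using nz \<open>h > 0\<close> by (simp add: g_def divide_le_0_iff)
  qed
  define d where "d = S v - c *\<^sub>R v"
  have dV: "d \<in> V"
    unfolding d_def using vV inv V by (auto intro: subspace_diff subspace_scale)
  have "v \<bullet> d = 0"
    by (simp add: d_def inner_simps v1 c_def inner_commute)
  with orth[OF dV] have "d \<bullet> d = 0"
    by (simp add: d_def inner_simps inner_commute)
  then have "S v = c *\<^sub>R v"
    by (simp add: d_def)
  then show thesis
    using that vV v by auto
qed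

text \<open>Split off one eigenvector; its orthogonal complement is invariant by symmetry.\<close>

lemma symmetric_orthonormal_eigenbasis:
  fixes S :: "'a::euclidean_space \<Rightarrow> 'a"
  assumes S: "linear S" and V: "subspace V" and inv: "\<And>v. v \<in> V \<Longrightarrow> S v \<in> V"
    and sym: "\<And>v w. v \<in> V \<Longrightarrow> w \<in> V \<Longrightarrow> S v \<bullet> w = S w \<bullet> v"
  shows "\<exists>E lam. finite E \<and> pairwise orthogonal E \<and> span E = V \<and>
           (\<forall>e\<in>E. norm e = 1 \<and> S e = lam e *\<^sub>R e)"
  using V inv sym
proof (induction "dim V" arbitrary: V rule: less_induct)
  case less
  show ?case
  proof (cases "V = {0}")
    case True
    then have "finite {} \<and> pairwise orthogonal {} \<and> span {} = V \<and> (\<forall>e\<in>{}. norm e = 1 \<and> S e = (0::real) *\<^sub>R e)"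
      by simp
    then show ?thesis by (intro exI)
  next
    case False
    obtain v c where v: "v \<in> V" "norm v = 1" "S v = c *\<^sub>R v"
      using symmetric_eigenvector[OF S less.prems(1) False less.prems(2,3)] by blast
    have v1: "v \<bullet> v = 1" using v by (simp add: dot_square_norm)
    let ?W = "V \<inter> {w. v \<bullet> w = 0}"
    have W: "subspace ?W"
      by (intro subspace_inter less.prems subspace_hyperplane)
    have "v \<notin> ?W" using v1 by simp
    then have "?W \<subset> V" using v(1) by blast
    then have "dim ?W < dim V"
      using W less.prems(1) by (intro dim_psubset) (simp add: span_eq_iff[THEN iffD2])
    moreover have "S w \<in> ?W" if "w \<in> ?W" for w
      using that less.prems(2) less.prems(3)[of v w] v by (auto simp: inner_commute)
    ultimately obtain E lam where E: "finite E" "pairwise orthogonal E" "span E = ?W"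
        "\<forall>e\<in>E. norm e = 1 \<and> S e = lam e *\<^sub>R e"
      using less.hyps[OF _ W] less.prems(3) by blast
    have EW: "e \<in> V" "v \<bullet> e = 0" if "e \<in> E" for e
      using span_base[OF that] E(3) by auto
    have "span (insert v E) = V"
    proof
      show "span (insert v E) \<subseteq> V"
        using EW v less.prems(1) by (intro span_minimal) auto
      show "V \<subseteq> span (insert v E)"
      proof
        fix x assume x: "x \<in> V"
        have "x - (v \<bullet> x) *\<^sub>R v \<in> ?W"
          using x v v1 less.prems(1) by (auto simp: inner_simps intro: subspace_diff subspace_scale)
        then show "x \<in> span (insert v E)"
          unfolding span_insert E(3) by blast
      qed
    qed
    moreover have "pairwise orthogonal (insert v E)"
      using E(2) EW by (auto simp: pairwise_insert orthogonal_def inner_commute)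
    moreover have "\<forall>e\<in>insert v E. norm e = 1 \<and> S e = (lam(v := c)) e *\<^sub>R e"
      using E(4) EW v v1 by auto
    ultimately show ?thesis
      using E(1) by (intro exI[of _ "insert v E"] exI[of _ "lam(v := c)"]) simp
  qed
qed


section \<open>Frames adapted to an abelian hyperplane ideal\<close>

text \<open>
  Here \<open>u\<close> is a unit normal of the ideal and \<open>E\<close> an orthonormal eigenbasis, with eigenvalues \<open>lam\<close>, of
  its shape operator \<open>x \<mapsto> - \<nabla>\<^sub>x u\<close>.  The bracket is recorded through the Levi-Civita connection on
  the frame.
\<close>

locale adapted_frame =
  fixes br :: "'a::euclidean_space \<Rightarrow> 'a \<Rightarrow> 'a" and u :: 'a and E :: "'a set" and lam :: "'a \<Rightarrow> real"
  assumes lie: "lie_bracket br"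
    and finite_E: "finite E" and u_notin: "u \<notin> E"
    and orthogonal_frame: "pairwise orthogonal (insert u E)"
    and unit: "\<And>e. e \<in> insert u E \<Longrightarrow> norm e = 1"
    and span_frame: "span (insert u E) = UNIV"
    and nabla_uu: "levi_civita br u u = 0"
    and nabla_ue: "\<And>e. e \<in> E \<Longrightarrow> levi_civita br u e \<in> span E"
    and nabla_eu: "\<And>e. e \<in> E \<Longrightarrow> levi_civita br e u = - lam e *\<^sub>R e"
    and nabla_ef: "\<And>e f. e \<in> E \<Longrightarrow> f \<in> E \<Longrightarrow> levi_civita br e f = (if e = f then lam e else 0) *\<^sub>R u"
begin

lemma card_E: "card E + 1 = DIM('a)"
proof -
  have "0 \<notin> insert u E" using unit by force
  then have "independent (insert u E)"
    using orthogonal_frame by (rule pairwise_orthogonal_independent[rotated])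
  then have "card (insert u E) = dim (insert u E)"
    by (rule dim_eq_card_independent[symmetric])
  also have "\<dots> = DIM('a)"
    using span_frame dim_span[of "insert u E"] by simp
  finally show ?thesis
    using finite_E u_notin by simp
qed

lemma orthogonal_distinct: "e \<in> insert u E \<Longrightarrow> f \<in> insert u E \<Longrightarrow> e \<noteq> f \<Longrightarrow> e \<bullet> f = 0"
  using orthogonal_frame by (auto simp: pairwise_def orthogonal_def)

context
  fixes \<omega> :: "'a list \<Rightarrow> real" and p :: nat
  assumes \<omega>: "alt_form p \<omega>"
begin

lemma update_nabla_u:
  assumes "e \<in> E" "k < length xs"
  shows "- \<omega> (xs[k := levi_civita br u e])
       = (\<Sum>f\<in>E. - (levi_civita br u e \<bullet> f) * \<omega> (xs[k := f]))"
proof -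
  have "(\<Sum>f\<in>E. (levi_civita br u e \<bullet> f) *\<^sub>R f) = levi_civita br u e"
    using orthogonal_frame unit finite_E nabla_ue[OF assms(1)]
    by (intro orthonormal_basis_expand) (auto simp: pairwise_insert)
  then show ?thesis
    using alt_form_update_sum[OF \<omega> assms(2), of "\<lambda>f. levi_civita br u e \<bullet> f" E]
    by (simp add: sum_negf)
qed

text \<open>
  \<open>\<nabla>\<^sub>u\<close> on the two types of components, those without \<open>u\<close> and those with \<open>u\<close> in front, in the shape
  required by \<open>skew_derivation_eigen_zero\<close>.  It preserves the types because \<open>\<nabla>\<^sub>u u = 0\<close>.
\<close>

lemma cov_deriv_u:
  assumes "set L \<subseteq> E"
  shows "cov_deriv br u \<omega> L
       = (\<Sum>k<length L. \<Sum>f\<in>E. - (levi_civita br u (L ! k) \<bullet> f) * \<omega> (L[k := f]))"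
    and "cov_deriv br u \<omega> (u # L)
       = (\<Sum>k<length L. \<Sum>f\<in>E. - (levi_civita br u (L ! k) \<bullet> f) * \<omega> (u # L[k := f]))"
proof -
  have in_E: "L ! k \<in> E" if "k < length L" for k
    using assms that by auto
  show "cov_deriv br u \<omega> L
       = (\<Sum>k<length L. \<Sum>f\<in>E. - (levi_civita br u (L ! k) \<bullet> f) * \<omega> (L[k := f]))"
    unfolding cov_deriv_def sum_negf[symmetric]
    by (intro sum.cong refl) (simp add: update_nabla_u in_E)
  have "cov_deriv br u \<omega> (u # L) = (\<Sum>k<length L. - \<omega> ((u # L)[Suc k := levi_civita br u (L ! k)]))"
    unfolding cov_deriv_def
    using alt_form_update_zero[OF \<omega>, of 0 "u # L"]
    by (simp add: sum.lessThan_Suc_shift nabla_uu sum_negf del: sum.lessThan_Suc)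
  also have "\<dots> = (\<Sum>k<length L. \<Sum>f\<in>E. - (levi_civita br u (L ! k) \<bullet> f) * \<omega> ((u # L)[Suc k := f]))"
    by (intro sum.cong refl update_nabla_u) (auto simp: in_E)
  finally show "cov_deriv br u \<omega> (u # L)
       = (\<Sum>k<length L. \<Sum>f\<in>E. - (levi_civita br u (L ! k) \<bullet> f) * \<omega> (u # L[k := f]))"
    by simp
qed

text \<open>
  The derivative \<open>\<nabla>\<^sub>e\<close> replaces \<open>u\<close> by \<open>- lam e e\<close> and \<open>e\<close> by \<open>lam e u\<close> and kills the rest of the frame.
  So it exchanges the two types of components.
\<close>

lemma cov_deriv_e:
  assumes e: "e \<in> E" and L: "set L \<subseteq> E"
  shows "e \<notin> set L \<Longrightarrow> cov_deriv br e \<omega> L = 0"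
    and "cov_deriv br e \<omega> (u # L) = lam e * \<omega> (e # L)"
    and "e \<notin> set L \<Longrightarrow> cov_deriv br e \<omega> (e # L) = - lam e * \<omega> (u # L)"
proof -
  have in_E: "L ! k \<in> E" if "k < length L" for k
    using L that by auto
  have zero: "\<omega> (xs[k := levi_civita br e (L ! i)]) = 0"
    if "e \<notin> set L" "i < length L" "k < length xs" for i k xs
  proof -
    have "levi_civita br e (L ! i) = 0"
      using that nabla_ef[OF e in_E[OF that(2)]] by (auto simp: in_set_conv_nth)
    then show ?thesis
      using alt_form_update_zero[OF \<omega> that(3)] by simp
  qed
  show "cov_deriv br e \<omega> L = 0" if "e \<notin> set L"
    by (simp add: cov_deriv_def zero that)
  \<comment> \<open>even if \<open>L ! i = e\<close>: its derivative is a multiple of \<open>u\<close>, which is already in front\<close>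
  have repeat: "\<omega> (u # L[i := levi_civita br e (L ! i)]) = 0" if "i < length L" for i
  proof -
    have "\<omega> ((u # L)[Suc i := u]) = 0"
      by (rule alt_form_repeated[OF \<omega>, of 0 _ "Suc i"]) (use that in auto)
    then show ?thesis
      using alt_form_update_scale[OF \<omega>, of "Suc i" "u # L" _ u] that nabla_ef[OF e in_E[OF that]]
      by simp
  qed
  have "\<omega> ((- lam e *\<^sub>R e) # L) = - lam e * \<omega> (e # L)"
    using alt_form_update_scale[OF \<omega>, of 0 "e # L" "- lam e" e] by simp
  then show "cov_deriv br e \<omega> (u # L) = lam e * \<omega> (e # L)"
    by (simp add: cov_deriv_def sum.lessThan_Suc_shift nabla_eu[OF e] repeat del: sum.lessThan_Suc)
  have "\<omega> ((lam e *\<^sub>R u) # L) = lam e * \<omega> (u # L)"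
    using alt_form_update_scale[OF \<omega>, of 0 "e # L" "lam e" u] by simp
  moreover have "\<omega> (e # L[i := levi_civita br e (L ! i)]) = 0" if "i < length L" "e \<notin> set L" for i
    using zero[OF that(2,1), of "Suc i" "e # L"] that by simp
  ultimately show "cov_deriv br e \<omega> (e # L) = - lam e * \<omega> (u # L)" if "e \<notin> set L"
    using that
    by (simp add: cov_deriv_def sum.lessThan_Suc_shift nabla_ef[OF e e] del: sum.lessThan_Suc)
qed

end

context
  fixes \<omega> :: "'a list \<Rightarrow> real" and p :: nat
  assumes ck: "conformal_killing br p \<omega>"
begin

lemma alt: "alt_form p \<omega>" and alt_cov: "alt_form p (cov_deriv br x \<omega>)"
  using ck lie alt_form_cov_deriv by (auto simp: conformal_killing_def lie_bracket_def)

text \<open>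
  With \<open>f\<close> in front, \<open>(\<nabla>\<^sub>u \<omega>)(f, ys) = - (\<nabla>\<^sub>f \<omega>)(u, ys)\<close> by polarization, and \<open>\<nabla>\<^sub>f\<close> is explicit.
  The general position of \<open>f\<close> follows because \<open>\<nabla>\<^sub>u \<omega> + lam f \<omega>\<close> is alternating.
\<close>

lemma cov_deriv_u_eigen:
  assumes L: "set L \<subseteq> E" and f: "f \<in> set L"
  shows "cov_deriv br u \<omega> L = - lam f * \<omega> L"
proof -
  have "cov_deriv br u \<omega> L + lam f * \<omega> L = 0"
  proof (rule alt_form_zero_if_leading[OF alt_form_add[OF alt_cov alt] f])
    fix ys assume ys: "distinct (f # ys)" "set (f # ys) = set L"
    have ys_E: "f \<in> E" "set ys \<subseteq> E"
      using ys(2) L f by auto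
    have "cov_deriv br u \<omega> (f # ys) = - cov_deriv br f \<omega> (u # ys)"
      using ys L u_notin
      by (intro conformal_killing_polarized(1)[OF lie ck] orthogonal_distinct) auto
    then show "cov_deriv br u \<omega> (f # ys) + lam f * \<omega> (f # ys) = 0"
      using cov_deriv_e(2)[OF alt ys_E] by simp
  qed
  then show ?thesis by simp
qed

text \<open>Here the other polarization identity applies: \<open>(\<nabla>\<^sub>u \<omega>)(u, L) = (\<nabla>\<^sub>f \<omega>)(f, L)\<close>.\<close>

lemma cov_deriv_u_eigen_normal:
  assumes L: "set L \<subseteq> E" and f: "f \<in> E - set L"
  shows "cov_deriv br u \<omega> (u # L) = - lam f * \<omega> (u # L)"
proof -
  have "cov_deriv br u \<omega> (u # L) = cov_deriv br f \<omega> (f # L)"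
    using f L u_notin unit
    by (intro conformal_killing_polarized(2)[OF lie ck] orthogonal_distinct) auto
  then show ?thesis
    using cov_deriv_e(3)[OF alt, of f L] f L by auto
qed

lemma cov_deriv_u_zero:
  assumes "2 \<le> p" and L: "set L \<subseteq> E" "length L = p"
  shows "cov_deriv br u \<omega> L = 0"
proof (rule skew_derivation_eigen_zero[OF finite_E _ _ _ L,
      where a = "\<lambda>f e. - (levi_civita br u e \<bullet> f)" and \<gamma> = \<omega>])
  show "- (levi_civita br u f \<bullet> e) = - (- (levi_civita br u e \<bullet> f))" for e f
    using levi_civita_skew[OF lie, of u f e] by simp
  fix L k e assume h: "set L \<subseteq> E" "length L = p" "k < p" "e \<in> E"
  \<comment> \<open>the entry in a slot other than \<open>k\<close> belongs to both lists and fixes a common eigenvalue\<close>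
  define j :: nat where "j = (if k = 0 then 1 else 0)"
  have j: "j < p" "j \<noteq> k"
    using \<open>2 \<le> p\<close> by (auto simp: j_def)
  have "L[k := e] ! j = L ! j" using j by simp
  then have "L ! j \<in> set L" "L ! j \<in> set (L[k := e])"
    using j h nth_mem[of j "L[k := e]"] by auto
  moreover have "set (L[k := e]) \<subseteq> E"
    using h by (meson insert_subset order_trans set_update_subset_insert)
  ultimately show "cov_deriv br u \<omega> L * \<omega> (L[k := e]) = cov_deriv br u \<omega> (L[k := e]) * \<omega> L"
    using h by (simp add: cov_deriv_u_eigen[of _ "L ! j"])
qed (use cov_deriv_u(1)[OF alt] in simp)

lemma cov_deriv_u_normal_zero:
  assumes p: "p + 2 \<le> DIM('a)" and L: "set L \<subseteq> E" "length L + 1 = p"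
  shows "cov_deriv br u \<omega> (u # L) = 0"
proof (rule skew_derivation_eigen_zero[OF finite_E _ _ _ L(1) refl,
      where a = "\<lambda>f e. - (levi_civita br u e \<bullet> f)" and \<gamma> = "\<lambda>L. \<omega> (u # L)"
        and F = "\<lambda>L. cov_deriv br u \<omega> (u # L)"])
  show "- (levi_civita br u f \<bullet> e) = - (- (levi_civita br u e \<bullet> f))" for e f
    using levi_civita_skew[OF lie, of u f e] by simp
  fix M k e assume h: "set M \<subseteq> E" "length M = length L" "k < length L" "e \<in> E"
  \<comment> \<open>a frame vector \<open>f\<close> outside both lists fixes a common eigenvalue; it exists as \<open>p < card E\<close>\<close>
  have "card (insert e (set M)) \<le> Suc (length M)"
    using card_length[of M] by (simp add: card_insert_if)
  also have "\<dots> < card E"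
    using p L h card_E by simp
  finally obtain f where f: "f \<in> E" "f \<notin> insert e (set M)"
    by (metis List.finite_set card_mono finite_insert leD subsetI)
  have M': "set (M[k := e]) \<subseteq> insert e (set M)"
    by (rule set_update_subset_insert)
  then have "f \<in> E - set M" "f \<in> E - set (M[k := e])" "set (M[k := e]) \<subseteq> E"
    using f h by auto
  then show "cov_deriv br u \<omega> (u # M) * \<omega> (u # M[k := e])
      = cov_deriv br u \<omega> (u # M[k := e]) * \<omega> (u # M)"
    using h by (simp add: cov_deriv_u_eigen_normal[of _ f])
qed (use cov_deriv_u(2)[OF alt] in simp)

lemma conformal_killing_parallel:
  assumes p: "2 \<le> p" "p + 2 \<le> DIM('a)"
  shows "cov_deriv br x \<omega> xs = 0"
proof -
  have lam_tangential: "lam f * \<omega> L = 0" if "set L \<subseteq> E" "length L = p" "f \<in> set L" for L f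
    using cov_deriv_u_zero[OF p(1) that(1,2)] cov_deriv_u_eigen[OF that(1,3)] by simp
  have lam_normal: "lam f * \<omega> (u # L) = 0" if "set L \<subseteq> E" "length L + 1 = p" "f \<in> E - set L" for L f
    using cov_deriv_u_normal_zero[OF p(2) that(1,2)] cov_deriv_u_eigen_normal[OF that(1,3)] by simp
  have u: "cov_deriv br u \<omega> xs = 0" for xs
  proof (rule alt_form_zero_if_spanning[OF alt_cov span_frame])
    fix xs assume xs: "distinct xs" "set xs \<subseteq> insert u E" "length xs = p"
    show "cov_deriv br u \<omega> xs = 0"
    proof (cases "u \<in> set xs")
      case True
      then show ?thesis
      proof (rule alt_form_zero_if_leading[OF alt_cov])
        fix ys assume ys: "distinct (u # ys)" "set (u # ys) = set xs" "length (u # ys) = length xs"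
        then have "set ys \<subseteq> E" using xs by auto
        then show "cov_deriv br u \<omega> (u # ys) = 0"
          using ys xs by (intro cov_deriv_u_normal_zero p) auto
      qed
    next
      case False
      then show ?thesis
        using xs by (intro cov_deriv_u_zero p) auto
    qed
  qed
  have e: "cov_deriv br e \<omega> xs = 0" if e: "e \<in> E" for e xs
  proof (rule alt_form_zero_if_spanning[OF alt_cov span_frame])
    fix xs assume xs: "distinct xs" "set xs \<subseteq> insert u E" "length xs = p"
    consider "u \<in> set xs" | "u \<notin> set xs" "e \<in> set xs" | "u \<notin> set xs" "e \<notin> set xs" by blast
    then show "cov_deriv br e \<omega> xs = 0"
    proof cases
      case 1
      then show ?thesis
      proof (rule alt_form_zero_if_leading[OF alt_cov])
        fix ys assume ys: "distinct (u # ys)" "set (u # ys) = set xs" "length (u # ys) = length xs"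
        then have "set ys \<subseteq> E" using xs by auto
        then show "cov_deriv br e \<omega> (u # ys) = 0"
          using cov_deriv_e(2)[OF alt e, of ys] lam_tangential[of "e # ys" e] e ys xs by simp
      qed
    next
      case 2
      show ?thesis
      proof (rule alt_form_zero_if_leading[OF alt_cov 2(2)])
        fix ys assume ys: "distinct (e # ys)" "set (e # ys) = set xs" "length (e # ys) = length xs"
        then have "set ys \<subseteq> E" using xs 2 by auto
        then show "cov_deriv br e \<omega> (e # ys) = 0"
          using cov_deriv_e(3)[OF alt e, of ys] lam_normal[of ys e] e ys xs by simp
      qed
    next
      case 3
      then show ?thesis
        using xs by (intro cov_deriv_e(1)[OF alt e]) auto
    qed
  qed
  have "linear (\<lambda>x. \<omega> (xs[k := levi_civita br x (xs ! k)]))" if "k < length xs" for k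
    using linear_compose[OF linear_levi_civita(2) alt_form_linear[OF that alt]] lie
    by (simp add: o_def lie_bracket_def)
  then have "linear (\<lambda>x. cov_deriv br x \<omega> xs)"
    unfolding cov_deriv_def by (intro linear_compose_neg linear_compose_sum) auto
  then show ?thesis
    by (rule linear_eq_0_on_span[of _ "insert u E"]) (use u e span_frame in auto)
qed

end

end

lemma almost_abelian_adapted_frame:
  fixes br :: "'a::euclidean_space \<Rightarrow> 'a \<Rightarrow> 'a"
  assumes lie: "lie_bracket br" and "almost_abelian br"
  obtains u E lam where "adapted_frame br u E lam"
proof -
  \<comment> \<open>all brackets lie in the ideal, hence are orthogonal to \<open>u\<close>; the rest is the Koszul formula\<close>
  let ?N = "levi_civita br"
  have b: "bilinear br" and diag: "br x x = 0" for x
    using lie by (auto simp: lie_bracket_def)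
  obtain I where I: "subspace I" "\<And>x y. y \<in> I \<Longrightarrow> br x y \<in> I"
    and abel: "\<And>x y. x \<in> I \<Longrightarrow> y \<in> I \<Longrightarrow> br x y = 0" and dim: "dim I + 1 = DIM('a)"
    using assms(2) by (auto simp: almost_abelian_def lie_ideal_def)
  have "dim I < DIM('a)" using dim by simp
  then obtain v where v: "v \<noteq> 0" "\<And>y. y \<in> span I \<Longrightarrow> orthogonal v y"
    by (rule orthogonal_to_subspace_exists) blast
  define u where "u = v /\<^sub>R norm v"
  have u1: "norm u = 1" "u \<bullet> u = 1" using v by (auto simp: u_def dot_square_norm)
  have "I \<subseteq> {y. u \<bullet> y = 0}"
    using v(2) span_base[of _ I] by (auto simp: u_def orthogonal_def)
  moreover have "dim {y. u \<bullet> y = 0} \<le> dim I"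
    using dim dim_hyperplane[of u] u1(1) by (cases "u = 0") auto
  ultimately have I_eq: "I = {y. u \<bullet> y = 0}"
    using I(1) by (intro subspace_dim_equal subspace_hyperplane)
  have dec: "x = (u \<bullet> x) *\<^sub>R u + (x - (u \<bullet> x) *\<^sub>R u)" "x - (u \<bullet> x) *\<^sub>R u \<in> I" for x
    using u1 by (auto simp: I_eq inner_simps)
  have swap: "br x y = - br y x" for x y by (rule lie_bracket_skew[OF lie])
  have bI: "br x y \<in> I" for x y
  proof -
    have left: "br x y \<in> I" if "x \<in> I" for x y
      using I(2)[OF that, of y] swap[of x y] subspace_neg[OF I(1)] by simp
    have "br x y = (u \<bullet> y) *\<^sub>R br x u + br x (y - (u \<bullet> y) *\<^sub>R u)"
      by (subst dec(1)[of y]) (simp only: bilinear_radd[OF b] bilinear_rmul[OF b])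
    moreover have "br x u = (u \<bullet> x) *\<^sub>R br u u + br (x - (u \<bullet> x) *\<^sub>R u) u"
      by (subst dec(1)[of x]) (simp only: bilinear_ladd[OF b] bilinear_lmul[OF b])
    ultimately show ?thesis
      using left[OF dec(2)] I(2)[OF dec(2)] I(1) by (simp add: diag subspace_add subspace_scale)
  qed
  then have bu: "br x y \<bullet> u = 0" for x y by (simp add: I_eq inner_commute)
  note koszul = levi_civita_koszul[OF b]
  have eqI: "v = w" if "\<And>z. 2 * (v \<bullet> z) = 2 * (w \<bullet> z)" for v w :: 'a
    using that by (intro vector_eq_rdot[THEN iffD1]) simp
  have Nuu: "?N u u = 0"
    by (rule eqI) (simp add: koszul bu diag)
  have normal: "?N x y \<bullet> u = - (?N x u \<bullet> y)" for x y by (rule levi_civita_skew[OF lie])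
  have Nxu: "?N x u \<bullet> u = 0" for x using normal[of x u] by simp
  define S where "S x = - ?N x u" for x
  have S: "linear S"
    unfolding S_def by (intro linear_compose_neg linear_levi_civita b)
  have SI: "S x \<in> I" for x
    using Nxu by (simp add: S_def I_eq inner_commute)
  have Ssym: "S x \<bullet> y = S y \<bullet> x" if "x \<in> I" "y \<in> I" for x y
  proof -
    have "2 * (?N x u \<bullet> y) = 2 * (?N y u \<bullet> x)"
      unfolding koszul using swap[of x u] swap[of y u] by (simp add: bu)
    then show ?thesis by (simp add: S_def)
  qed
  have Nxy: "?N x y = (S x \<bullet> y) *\<^sub>R u" if "x \<in> I" "y \<in> I" for x y
  proof (rule vector_eq_rdot[THEN iffD1], rule allI)
    fix z
    have "2 * (?N x y \<bullet> w) = 0" if "w \<in> I" for w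
      unfolding koszul using abel that \<open>x \<in> I\<close> \<open>y \<in> I\<close> by simp
    then have "?N x y \<bullet> (z - (u \<bullet> z) *\<^sub>R u) = 0"
      using dec(2)[of z] by simp
    then have "?N x y \<bullet> z = (u \<bullet> z) * (?N x y \<bullet> u)"
      by (simp add: inner_diff_right)
    then show "?N x y \<bullet> z = ((S x \<bullet> y) *\<^sub>R u) \<bullet> z"
      by (simp add: normal S_def)
  qed
  have Nuy: "?N u y \<in> I" for y
    using normal[of u y] Nuu by (simp add: I_eq inner_commute)
  obtain E lam where E: "finite E" "pairwise orthogonal E" "span E = I"
      "\<forall>e\<in>E. norm e = 1 \<and> S e = lam e *\<^sub>R e"
    using symmetric_orthonormal_eigenbasis[OF S I(1) SI Ssym] by blast
  have EI: "e \<in> I" if "e \<in> E" for e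
    using that E(3) span_base by blast
  have "adapted_frame br u E lam"
  proof
    show "u \<notin> E" using EI[of u] u1 by (auto simp: I_eq)
    show "pairwise orthogonal (insert u E)"
      using E(2) EI by (auto simp: pairwise_insert orthogonal_def I_eq inner_commute)
    show "span (insert u E) = UNIV"
      unfolding span_insert E(3) using dec(2) by blast
    show "?N e u = - lam e *\<^sub>R e" if "e \<in> E" for e
    proof -
      have "- ?N e u = lam e *\<^sub>R e" using E(4) that by (simp flip: S_def)
      then show ?thesis by (metis minus_minus scaleR_minus_left)
    qed
    show "?N e f = (if e = f then lam e else 0) *\<^sub>R u" if "e \<in> E" "f \<in> E" for e f
      using Nxy[OF EI EI, OF that] E(2,4) that
      by (auto simp: pairwise_def orthogonal_def dot_square_norm)
  qed (use lie E u1 Nuu Nuy in auto)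
  then show thesis by (rule that)
qed

section \<open>Forms of top degree\<close>

text \<open>
  A list of \<open>n\<close> distinct basis vectors contains the whole basis.  So when the entry \<open>e\<close> in one slot is
  replaced by \<open>\<nabla>\<^sub>x e\<close>, only the component of \<open>\<nabla>\<^sub>x e\<close> along \<open>e\<close> itself could contribute, and it is \<open>0\<close>.
\<close>

lemma top_form_parallel:
  fixes br :: "'a::euclidean_space \<Rightarrow> 'a \<Rightarrow> 'a"
  assumes lie: "lie_bracket br" and \<omega>: "alt_form DIM('a) \<omega>"
  shows "cov_deriv br x \<omega> xs = 0"
proof (rule alt_form_zero_if_spanning[OF alt_form_cov_deriv[OF _ \<omega>] span_Basis])
  show "bilinear br" using lie by (simp add: lie_bracket_def)
  let ?N = "levi_civita br x"
  fix xs :: "'a list" assume xs: "distinct xs" "set xs \<subseteq> Basis" "length xs = DIM('a)"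
  have set_xs: "set xs = Basis"
    using xs by (intro card_subset_eq) (auto simp: distinct_card)
  have "\<omega> (xs[k := ?N (xs ! k)]) = 0" if k: "k < length xs" for k
  proof -
    have "(?N (xs ! k) \<bullet> e) * \<omega> (xs[k := e]) = 0" if e: "e \<in> Basis" for e
    proof -
      obtain j where j: "j < length xs" "xs ! j = e"
        using e set_xs by (metis in_set_conv_nth)
      show ?thesis
      proof (cases "j = k")
        case True
        then show ?thesis using levi_civita_skew[OF lie, of x e e] j by simp
      next
        case False
        then have "\<omega> (xs[k := e]) = 0"
          using j k by (intro alt_form_repeated[OF \<omega>, of j _ k]) auto
        then show ?thesis by simp
      qed
    qed
    then have "\<omega> (xs[k := (\<Sum>e\<in>Basis. (?N (xs ! k) \<bullet> e) *\<^sub>R e)]) = 0"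
      by (subst alt_form_update_sum[OF \<omega> k]) (rule sum.neutral, blast)
    then show ?thesis by (simp add: euclidean_representation)
  qed
  then show "cov_deriv br x \<omega> xs = 0" by (simp add: cov_deriv_def)
qed

theorem corollary3p8:
  fixes br :: "'a::euclidean_space \<Rightarrow> 'a \<Rightarrow> 'a"
  assumes "lie_bracket br" and "almost_abelian br"
  shows "(\<forall>p \<omega>. 2 \<le> p \<and> p + 2 \<le> DIM('a) \<and> conformal_killing br p \<omega> \<longrightarrow> parallel_form br \<omega>) \<and>
         (\<forall>p. 1 \<le> p \<and> p \<le> DIM('a) \<and> (\<exists>\<omega>. conformal_killing br p \<omega> \<and> \<not> parallel_form br \<omega>)
            \<longrightarrow> p = 1 \<or> p = DIM('a) - 1)"
proof -
  obtain u E lam where "adapted_frame br u E lam"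
    using almost_abelian_adapted_frame[OF assms] by blast
  then interpret adapted_frame br u E lam .
  have middle: "parallel_form br \<omega>"
    if "2 \<le> p" "p + 2 \<le> DIM('a)" "conformal_killing br p \<omega>" for p \<omega>
    using conformal_killing_parallel[OF that(3,1,2)] by (simp add: parallel_form_def)
  have top: "parallel_form br \<omega>" if "conformal_killing br DIM('a) \<omega>" for \<omega>
  proof -
    have "alt_form DIM('a) \<omega>" using that by (simp add: conformal_killing_def)
    then show ?thesis
      by (simp add: parallel_form_def top_form_parallel[OF assms(1)])
  qed
  have "p = 1 \<or> p = DIM('a) - 1"
    if p: "1 \<le> p" "p \<le> DIM('a)" and \<omega>: "conformal_killing br p \<omega>" "\<not> parallel_form br \<omega>" for p \<omega>
  proof (rule ccontr)
    assume "\<not> ?thesis"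
    moreover have "p \<noteq> DIM('a)" using top \<omega> by blast
    ultimately have "2 \<le> p" "p + 2 \<le> DIM('a)" using p by linarith+
    with middle \<omega> show False by blast
  qed
  with middle show ?thesis by blast
qed

end
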